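(* Let $A=A^\top\in\mathbb{R}^{3\times3}$ be such that $\bar A=\frac12(\mathrm{tr}(A)I-A)$ is positive definite and let $\epsilon>0$. For $i=1,2,3$ consider the system $$\dot{\mathcal{Z}}(\tilde R)=-k_i(\mathcal{Z}(\tilde R))\,\bar A\,\mathcal{Z}(\tilde R)-g(\mathcal{Z}(\tilde R))\,\hat R\,n_\omega ,\qquad (S_i)$$ with state $\mathcal{Z}(\tilde R)\in\mathbb{R}^3$, input $n_\omega(t)\in\mathbb{R}^3$ and $\hat R(t)\in SO(3)$, where, for $z\in\mathbb{R}^3$, $$k_1(z)=1,\quad k_2(z)=\left(\frac{1+\|z\|^2}{1+\epsilon(1+\|z\|^2)}\right)^{1/2},\quad k_3(z)=\frac{1+\|z\|^2}{1+\epsilon(1+\|z\|^2)},$$ $$g(z)=\tfrac12\big(I+[z]_\times+zz^\top\big).$$ Then each of the systems $(S_1),(S_2),(S_3)$ is locally input-to-state stable (with respect to $n_\omega$). In particular, for each $i\in\{1,2,3\}$ and for all $r>0$ and $0<\varrho<1$, there exists $\beta_i\in\mathcal{KL}$ such that for all $\|\mathcal{Z}(\tilde R(0))\|<r$ and all $n_\omega$ with $\sup_{t\ge0}\|n_\omega(t)\|<k_{ui}$, one has $$\|\mathcal{Z}(\tilde R(t))\|\le\beta_i(\|\mathcal{Z}(\tilde R(0))\|,t)+\gamma_i\big(\sup_{t\ge0}\|n_\omega(t)\|\big),\qquad \forall t\ge0,$$ where $k_{ui}=\gamma_i^{-1}(r)$, $\gamma_i(s)=\dfrac{\varsigma_i(r)\,s}{2\varrho\lambda_{\min}^{\bar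 A}}$, and $$\varsigma_1(r)=1+r^2,\qquad \varsigma_2(r)=\big((1+r^2)(1+\epsilon+\epsilon r^2)\big)^{1/2},\qquad \varsigma_3(r)=1+\epsilon+\epsilon r^2.$$
   Context: $[x]_\times$ is the skew-symmetric matrix with $[x]_\times y=x\times y$ for $x,y\in\mathbb{R}^3$. $\lambda_{\min}^{\bar A}$ is the minimum eigenvalue of $\bar A$. The inputs $n_\omega$ are piecewise continuous, bounded functions of $t\ge0$. Local input-to-state stability: a system $\dot x=f(x,u)$ is locally input-to-state stable if there exist $k_x,k_u>0$, $\gamma\in\mathcal{K}$ and $\beta\in\mathcal{KL}$ such that $\|x(0)\|<k_x$ and $\sup_{t\ge0}\|u(t)\|<k_u$ imply $\|x(t)\|\le\beta(\|x(0)\|,t)+\gamma(\sup_{t\ge0}\|u(t)\|)$ for all $t\ge0$. Origin of the systems (for information): $\tilde R=R\hat R^\top$ with $\dot R=R[\omega]_\times$, and $\hat R$ given by $\dot{\hat R}=\hat R[\omega_y]_\times-[\sigma]_\times\hat R$, with gyro measurement $\omega_y=\omega+n_\omega$, perfect attitude measurement, and $\sigma=-k_i\,\psi(A\tilde R)$, where $k_i$ as a function of $\tilde R$ equals $1$, $[1+\epsilon-|\tilde R|_I^2]^{-1/2}$, $[1+\epsilon-|\tilde R|_I^2]^{-1}$ for $i=1,2,3$ respectively. Here $|R|_I^2=\frac14\mathrm{tr}(I-R)$, $\psi(M)=\mathrm{vex}((M-M^\top)/2)$ with $\mathrm{vex}$ the inverse of $[\cdot]_\times$, and $\mathcal{Z}(R)=\mathrm{vex}((R-I)(R+I)^{-1})$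 is the Rodrigues vector of $R\in SO(3)$ with $|R|_I\neq1$. *)

theory Defs
  imports "HOL-Analysis.Analysis"
begin

definition class_K :: "(real \<Rightarrow> real) \<Rightarrow> bool" where
  "class_K \<alpha> \<longleftrightarrow> \<alpha> 0 = 0 \<and> continuous_on {0..} \<alpha> \<and> strict_mono_on {0..} \<alpha>"

definition class_KL :: "(real \<Rightarrow> real \<Rightarrow> real) \<Rightarrow> bool" where
  "class_KL \<beta> \<longleftrightarrow>
     continuous_on ({0..} \<times> {0..}) (\<lambda>(s, t). \<beta> s t) \<and>
     (\<forall>t\<ge>0. class_K (\<lambda>s. \<beta> s t)) \<and>
     (\<forall>s\<ge>0. antimono_on {0..} (\<beta> s) \<and> (\<beta> s \<longlongrightarrow> 0) at_top)"

definition piecewise_continuous :: "(real \<Rightarrow> 'a::topological_space) \<Rightarrow> bool" where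
  "piecewise_continuous u \<longleftrightarrow>
     (\<forall>b. finite {t \<in> {0..b}. \<not> continuous (at t within {0..}) u}) \<and>
     (\<forall>t\<ge>0. \<exists>l. (u \<longlongrightarrow> l) (at_right t)) \<and>
     (\<forall>t>0. \<exists>l. (u \<longlongrightarrow> l) (at_left t))"

text \<open>
  The right-hand side may jump with the inputs, so a solution is a continuous function satisfying
  the differential equation off a locally finite set of times.
\<close>

definition solves_on ::
  "(real \<Rightarrow> 'x::real_normed_vector \<Rightarrow> 'x) \<Rightarrow> (real \<Rightarrow> 'x) \<Rightarrow> real set \<Rightarrow> bool" where
  "solves_on F x J \<longleftrightarrow>
     continuous_on J x \<and>
     (\<exists>S. (\<forall>b. finite (S \<inter> {0..b})) \<and>
          (\<forall>t \<in> J - S. (x has_vector_derivative F t (x t)) (at t within J)))"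

abbreviation sup_norm :: "(real \<Rightarrow> 'u::real_normed_vector) \<Rightarrow> real" where
  "sup_norm u \<equiv> (SUP t\<in>{0..}. norm (u t))"

text \<open>
  The system is \<open>x' = f x (w t) (u t)\<close>, where \<open>u\<close> is the input with respect to which stability is
  measured and \<open>w\<close> is a further time-varying signal with values in \<open>W\<close>; the bounds are uniform
  in \<open>w\<close>. The estimate is imposed on solutions over every time interval starting at \<open>0\<close>, so
  that solutions with finite escape time are covered too. Existence of a solution on \<open>[0,\<infinity>)\<close> is
  part of the estimate holding for all \<open>t \<ge> 0\<close>.
\<close>

definition iss_estimate ::
  "'w::topological_space set \<Rightarrow> ('x::real_normed_vector \<Rightarrow> 'w \<Rightarrow> 'u::real_normed_vector \<Rightarrow> 'x) \<Rightarrow>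
   real \<Rightarrow> real \<Rightarrow> (real \<Rightarrow> real \<Rightarrow> real) \<Rightarrow> (real \<Rightarrow> real) \<Rightarrow> bool" where
  "iss_estimate W f k\<^sub>x k\<^sub>u \<beta> \<gamma> \<longleftrightarrow>
     (\<forall>x\<^sub>0 w u.
        norm x\<^sub>0 < k\<^sub>x \<and>
        piecewise_continuous w \<and> (\<forall>t\<ge>0. w t \<in> W) \<and>
        piecewise_continuous u \<and> bounded (u ` {0..}) \<and> sup_norm u < k\<^sub>u \<longrightarrow>
        (\<exists>x. x 0 = x\<^sub>0 \<and> solves_on (\<lambda>t y. f y (w t) (u t)) x {0..}) \<and>
        (\<forall>J x. is_interval J \<and> 0 \<in> J \<and> J \<subseteq> {0..} \<and>
               x 0 = x\<^sub>0 \<and> solves_on (\<lambda>t y. f y (w t) (u t)) x J \<longrightarrow>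
               (\<forall>t\<in>J. norm (x t) \<le> \<beta> (norm x\<^sub>0) t + \<gamma> (sup_norm u))))"

definition locally_iss ::
  "'w::topological_space set \<Rightarrow> ('x::real_normed_vector \<Rightarrow> 'w \<Rightarrow> 'u::real_normed_vector \<Rightarrow> 'x) \<Rightarrow>
   bool" where
  "locally_iss W f \<longleftrightarrow>
     (\<exists>k\<^sub>x>0. \<exists>k\<^sub>u>0. \<exists>\<gamma> \<beta>. class_K \<gamma> \<and> class_KL \<beta> \<and> iss_estimate W f k\<^sub>x k\<^sub>u \<beta> \<gamma>)"

definition SO3 :: "(real^3^3) set" where
  "SO3 = {R. rotation_matrix R}"

definition skew :: "real^3 \<Rightarrow> real^3^3" where
  "skew x = matrix (cross3 x)"

lemma skew_mult_vec: "skew x *v y = cross3 x y"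
  unfolding skew_def
  by (simp add: vec_eq_iff forall_3 matrix_vector_mult_def matrix_def sum_3 cross3_simps axis_def)

definition pos_def :: "real^'n^'n \<Rightarrow> bool" where
  "pos_def M \<longleftrightarrow> transpose M = M \<and> (\<forall>x. x \<noteq> 0 \<longrightarrow> x \<bullet> (M *v x) > 0)"

definition is_eigenvalue :: "real^'n^'n \<Rightarrow> real \<Rightarrow> bool" where
  "is_eigenvalue M l \<longleftrightarrow> (\<exists>v. v \<noteq> 0 \<and> M *v v = l *\<^sub>R v)"

definition lambda_min :: "real^'n^'n \<Rightarrow> real" where
  "lambda_min M = (LEAST l. is_eigenvalue M l)"

definition bar :: "real^3^3 \<Rightarrow> real^3^3" where
  "bar A = (1/2) *\<^sub>R (trace A *\<^sub>R mat 1 - A)"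

datatype index = I1 | I2 | I3

fun gain :: "real \<Rightarrow> index \<Rightarrow> real^3 \<Rightarrow> real" where
  "gain \<epsilon> I1 z = 1"
| "gain \<epsilon> I2 z = sqrt ((1 + (norm z)\<^sup>2) / (1 + \<epsilon> * (1 + (norm z)\<^sup>2)))"
| "gain \<epsilon> I3 z = (1 + (norm z)\<^sup>2) / (1 + \<epsilon> * (1 + (norm z)\<^sup>2))"

definition g :: "real^3 \<Rightarrow> real^3^3" where
  "g z = (1/2) *\<^sub>R (mat 1 + skew z + (\<chi> i j. z $ i * z $ j))"

text \<open>
  The state \<open>z\<close> is the Rodrigues vector of the attitude error, \<open>Rhat\<close> the attitude estimate
  and \<open>n\<close> the gyro noise.
\<close>

definition error_system :: "real^3^3 \<Rightarrow> real \<Rightarrow> index \<Rightarrow> real^3 \<Rightarrow> real^3^3 \<Rightarrow> real^3 \<Rightarrow> real^3" where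
  "error_system A \<epsilon> i z Rhat n =
     - (gain \<epsilon> i z *\<^sub>R (bar A *v z)) - g z *v (Rhat *v n)"

fun varsigma :: "real \<Rightarrow> index \<Rightarrow> real \<Rightarrow> real" where
  "varsigma \<epsilon> I1 r = 1 + r\<^sup>2"
| "varsigma \<epsilon> I2 r = sqrt ((1 + r\<^sup>2) * (1 + \<epsilon> + \<epsilon> * r\<^sup>2))"
| "varsigma \<epsilon> I3 r = 1 + \<epsilon> + \<epsilon> * r\<^sup>2"

definition iss_gain :: "real^3^3 \<Rightarrow> real \<Rightarrow> index \<Rightarrow> real \<Rightarrow> real \<Rightarrow> real \<Rightarrow> real" where
  "iss_gain A \<epsilon> i r \<rho> s = varsigma \<epsilon> i r * s / (2 * \<rho> * lambda_min (bar A))"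

end

theory Submission
  imports Defs
begin

text \<open>
  The proof is a Lyapunov argument with \<open>V z = (norm z)\<^sup>2 / 2\<close>. Taking the inner product of
  \<open>z\<close> with the right-hand side removes the cross product, and the remaining noise term is
  \<open>(1 + (norm z)\<^sup>2) / 2\<close> times \<open>z \<bullet> (R *v n)\<close>, where the rotation \<open>R\<close> preserves the norm of \<open>n\<close>.
  The damping term is at least \<open>gain \<epsilon> i z * lambda_min (bar A) * (norm z)\<^sup>2\<close>, since the smallest
  eigenvalue is the minimum of the Rayleigh quotient. Everything hinges on the ratio
  \<open>(1 + (norm z)\<^sup>2) / gain \<epsilon> i z\<close>: it equals \<open>varsigma \<epsilon> i (norm z)\<close> and grows with \<open>norm z\<close>.
  So for \<open>iss_gain A \<epsilon> i r \<rho> (sup_norm u) \<le> norm z \<le> r\<close> the noise eats up at most the fraction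
  \<open>\<rho>\<close> of the damping, and because the gain never drops below \<open>1 / (1 + \<epsilon>)\<close>, the function \<open>V\<close>
  decays exponentially there, uniformly in time (\<open>error_system_dissipation\<close>).

  The number \<open>iss_gain A \<epsilon> i r \<rho> (sup_norm u)\<close> is below \<open>r\<close> by the choice of the input bound. So a
  state that starts inside the ball of radius \<open>r\<close> stays there, and its norm decays exponentially
  for as long as it exceeds that number (\<open>norm_decay_outside_ball\<close>). This gives the estimate with \<open>\<beta> s t = s * exp (- \<mu> * t)\<close>, for
  \<open>\<mu> = (1 - \<rho>) * lambda_min (bar A) / (1 + \<epsilon>)\<close>.

  A solution on all of \<open>[0,\<infinity>)\<close> has to be produced as well, although the vector field grows
  quadratically. It is composed with the projection onto the ball of radius \<open>r\<close>, which makes it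
  bounded and globally Lipschitz, so that a contraction argument applies
  (\<open>global_solution_if_bounded_Lipschitz\<close>). The a priori estimate keeps the resulting solution
  inside the ball, where both vector fields agree.
\<close>

section \<open>A differential inequality outside a ball\<close>

text \<open>
  The fundamental theorem of calculus tolerates finitely many exceptional points, so the usual
  mean value argument is replaced by integrating the derivative.
\<close>

lemma nonincreasing_if_deriv_nonpos_off_finite:
  fixes f :: "real \<Rightarrow> real"
  assumes "finite S" and "a \<le> b" and "continuous_on {a..b} f"
    and "\<And>t. t \<in> {a<..<b} - S \<Longrightarrow> (f has_real_derivative f' t) (at t)"
    and "\<And>t. t \<in> {a<..<b} - S \<Longrightarrow> f' t \<le> 0"
  shows "f b \<le> f a"
proof -
  define h where "h t = (if t \<in> {a<..<b} - S then f' t else 0)" for t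
  have "(h has_integral (f b - f a)) {a..b}"
    using assms
    by (intro fundamental_theorem_of_calculus_interior_strong)
       (auto simp: h_def simp flip: has_real_derivative_iff_has_vector_derivative)
  moreover have "((\<lambda>t. 0::real) has_integral 0) {a..b}" by simp
  ultimately have "f b - f a \<le> 0"
    by (rule has_integral_le) (use assms(5) in \<open>auto simp: h_def\<close>)
  then show ?thesis by simp
qed

text \<open>
  The decay condition is known only in the shell between radii \<open>d\<close> and \<open>r\<close>, so one cannot simply
  integrate it from time \<open>0\<close>. If the bound failed at \<open>t\<close>, consider the last earlier time \<open>a\<close> at
  which it holds. Shortly after \<open>a\<close> the state is above the bound, hence above \<open>d\<close>, and by
  continuity still below \<open>r\<close>; the decay condition applies there and forces the bound to persist,
  a contradiction. This also shows that the solution never leaves the ball of radius \<open>r\<close>.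
\<close>

lemma norm_decay_outside_ball:
  fixes F :: "real \<Rightarrow> 'a::real_inner \<Rightarrow> 'a"
  assumes sol: "solves_on F x J" and J: "is_interval J" "0 \<in> J" "J \<subseteq> {0..}"
    and decay: "\<And>t z. t \<ge> 0 \<Longrightarrow> d < norm z \<Longrightarrow> norm z < r \<Longrightarrow> z \<bullet> F t z \<le> - \<mu> * (norm z)\<^sup>2"
    and "\<mu> \<ge> 0" "0 \<le> d" "d < r" "norm (x 0) < r" "t \<in> J"
  shows "norm (x t) \<le> max (norm (x 0) * exp (- \<mu> * t)) d"
proof (rule ccontr)
  define m where "m s = max (norm (x 0) * exp (- \<mu> * s)) d" for s
  have m_less: "m s < r" if "s \<ge> 0" for s
  proof -
    have "norm (x 0) * exp (- \<mu> * s) \<le> norm (x 0) * 1"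
      using that \<open>\<mu> \<ge> 0\<close> by (intro mult_left_mono) auto
    then show ?thesis using assms(7-9) by (simp add: m_def)
  qed
  assume "\<not> norm (x t) \<le> max (norm (x 0) * exp (- \<mu> * t)) d"
  then have above: "m t < norm (x t)" unfolding m_def by linarith
  have "t \<ge> 0" using J \<open>t \<in> J\<close> by auto
  have sub: "{0..t} \<subseteq> J"
    using J(1,2) \<open>t \<in> J\<close> by (meson mem_is_interval_1_I atLeastAtMost_iff subsetI)
  have cx: "continuous_on {0..t} x"
    using sol sub continuous_on_subset unfolding solves_on_def by blast
  obtain S where S: "\<And>b. finite (S \<inter> {0..b})"
    and dx: "\<And>s. s \<in> J - S \<Longrightarrow> (x has_vector_derivative F s (x s)) (at s within J)"
    using sol unfolding solves_on_def by blast
  define e where "e s = norm (x s) - m s" for s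
  have ce: "continuous_on {0..t} e"
    unfolding e_def m_def by (intro continuous_intros cx)
  define B where "B = {s \<in> {0..t}. e s \<le> 0}"
  have "closed B"
    unfolding B_def using continuous_on_closed_Collect_le[OF ce continuous_on_const] by simp
  moreover have "0 \<in> B"
    using \<open>t \<ge> 0\<close> by (simp add: B_def e_def m_def)
  moreover have bdd: "bdd_above B" unfolding B_def by (intro bdd_aboveI[of _ t]) auto
  define a where "a = Sup B"
  ultimately have "a \<in> B" unfolding a_def using bdd by (intro closed_contains_Sup) auto
  then have a: "0 \<le> a" "a \<le> t" "norm (x a) \<le> m a" by (auto simp: B_def e_def)
  moreover have "a \<noteq> t" using a(3) above by auto
  ultimately have "a < t" by simp
  have after: "m s < norm (x s)" if "a < s" "s \<le> t" for s
  proof (rule ccontr)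
    assume "\<not> m s < norm (x s)"
    then have "s \<in> B" using that a(1) by (simp add: B_def e_def)
    then show False using cSup_upper[OF _ bdd, of s] \<open>a < s\<close> by (simp add: a_def)
  qed
  have exp_m: "exp (\<mu> * s) * m s = max (norm (x 0)) (exp (\<mu> * s) * d)" for s
  proof -
    have "exp (\<mu> * s) * (norm (x 0) * exp (- \<mu> * s)) = norm (x 0)"
      by (simp add: exp_minus field_simps)
    then show ?thesis
      by (simp only: m_def max_mult_distrib_left exp_ge_zero if_True)
  qed
  obtain b where b:
    "a < b" "b \<le> t" and inside: "\<And>s. s \<in> {a..b} \<Longrightarrow> norm (x s) < r"
  proof -
    have "norm (x a) < r" using a m_less[of a] by simp
    then have "r - norm (x a) > 0" by simp
    moreover have "continuous (at a within {0..t}) x"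
      using cx a by (auto simp: continuous_on_eq_continuous_within)
    ultimately obtain \<delta> where \<delta>: "\<delta> > 0"
      "\<And>s. s \<in> {0..t} \<Longrightarrow> dist s a < \<delta> \<Longrightarrow> dist (x s) (x a) < r - norm (x a)"
      unfolding continuous_within_eps_delta by blast
    show thesis
    proof (rule that[of "min t (a + \<delta> / 2)"])
      fix s assume "s \<in> {a..min t (a + \<delta> / 2)}"
      then have "dist (x s) (x a) < r - norm (x a)"
        using a \<delta>(1) by (intro \<delta>(2)) (auto simp: dist_real_def)
      then show "norm (x s) < r"
        using norm_triangle_ineq2[of "x s" "x a"] by (simp add: dist_norm)
    qed (use \<open>a < t\<close> \<open>\<delta> > 0\<close> in auto)
  qed
  \<comment> \<open>The factor \<open>exp (2 * \<mu> * s)\<close> turns the differential inequality into monotonicity.\<close>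
  have "exp (2 * \<mu> * b) * (x b \<bullet> x b) \<le> exp (2 * \<mu> * a) * (x a \<bullet> x a)"
  proof (rule nonincreasing_if_deriv_nonpos_off_finite[OF S[of t], where
        f = "\<lambda>s. exp (2 * \<mu> * s) * (x s \<bullet> x s)" and
        f' = "\<lambda>s. 2 * exp (2 * \<mu> * s) * (\<mu> * (x s \<bullet> x s) + x s \<bullet> F s (x s))"])
    fix s assume s: "s \<in> {a<..<b} - S \<inter> {0..t}"
    then have s': "s \<in> {0<..<t} - S" using a b by auto
    have "s \<in> interior J"
      using s' interior_mono[OF sub] by auto
    then have "at s within J = at s" by (rule at_within_interior)
    then have "(x has_vector_derivative F s (x s)) (at s)"
      using dx[of s] s' sub by fastforce
    then have "((\<lambda>s. x s \<bullet> x s) has_real_derivative (2 * (x s \<bullet> F s (x s)))) (at s)"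
      unfolding has_real_derivative_iff_has_vector_derivative
      using bounded_bilinear.has_vector_derivative[OF bounded_bilinear_inner]
      by (fastforce simp: inner_commute)
    then show "((\<lambda>s. exp (2 * \<mu> * s) * (x s \<bullet> x s)) has_real_derivative
        2 * exp (2 * \<mu> * s) * (\<mu> * (x s \<bullet> x s) + x s \<bullet> F s (x s))) (at s)"
      by (auto intro!: derivative_eq_intros simp: algebra_simps)
    have "d < norm (x s)" using after[of s] s b by (auto simp: m_def)
    then have "x s \<bullet> F s (x s) \<le> - \<mu> * (norm (x s))\<^sup>2"
      using s s' inside[of s] by (intro decay) auto
    then show "2 * exp (2 * \<mu> * s) * (\<mu> * (x s \<bullet> x s) + x s \<bullet> F s (x s)) \<le> 0"
      by (intro mult_nonneg_nonpos) (auto simp: power2_norm_eq_inner)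
  next
    have "continuous_on {a..b} x" using cx a b by (auto intro: continuous_on_subset)
    then show "continuous_on {a..b} (\<lambda>s. exp (2 * \<mu> * s) * (x s \<bullet> x s))"
      by (intro continuous_intros)
  qed (use b in simp)
  then have "(exp (\<mu> * b) * norm (x b))\<^sup>2 \<le> (exp (\<mu> * a) * norm (x a))\<^sup>2"
    by (simp add: power_mult_distrib power2_norm_eq_inner flip: exp_double)
       (simp add: mult.assoc)
  then have "exp (\<mu> * b) * norm (x b) \<le> exp (\<mu> * a) * norm (x a)"
    by (rule power2_le_imp_le) simp
  also have "\<dots> \<le> exp (\<mu> * a) * m a"
    using a by simp
  also have "\<dots> = max (norm (x 0)) (exp (\<mu> * a) * d)"
    by (rule exp_m)
  also have "\<dots> \<le> max (norm (x 0)) (exp (\<mu> * b) * d)"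
    using b \<open>\<mu> \<ge> 0\<close> \<open>0 \<le> d\<close> by (intro max.mono mult_right_mono) (auto intro: mult_left_mono)
  also have "\<dots> = exp (\<mu> * b) * m b"
    by (rule exp_m[symmetric])
  finally have "norm (x b) \<le> m b" by simp
  with after[of b] b show False by simp
qed

section \<open>Global solutions for bounded Lipschitz right-hand sides\<close>

lemma integrable_if_bounded_continuous_off_finite:
  fixes f :: "real \<Rightarrow> 'a::euclidean_space"
  assumes "finite S" and "continuous_on ({a..b} - S) f"
    and "\<And>t. t \<in> {a..b} \<Longrightarrow> norm (f t) \<le> M"
  shows "f integrable_on {a..b}"
proof -
  have lm: "{a..b} - S \<in> sets lebesgue"
    using \<open>finite S\<close> by (simp add: finite_imp_closed)
  then have "f \<in> borel_measurable (lebesgue_on ({a..b} - S))"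
    using assms(2) by (rule continuous_imp_measurable_on_sets_lebesgue[rotated])
  moreover have "(\<lambda>t. M) integrable_on ({a..b} - S)"
    by (rule integrable_spike_set[OF integrable_const_ivl[of M a b]])
       (auto intro!: negligible_subset[OF negligible_finite[OF \<open>finite S\<close>]])
  ultimately have "f integrable_on ({a..b} - S)"
    by (rule measurable_bounded_by_integrable_imp_integrable) (use lm assms(3) in auto)
  then show ?thesis
    by (rule integrable_spike_set)
       (auto intro!: negligible_subset[OF negligible_finite[OF \<open>finite S\<close>]])
qed

text \<open>
  The Picard operator \<open>\<Phi>\<close> is conjugated with the weight \<open>exp (K * t)\<close> (a Bielecki norm): in the
  variable \<open>y t = exp (- K * t) *\<^sub>R x t\<close> it contracts by the factor \<open>L / K < 1 / 2\<close> on the whole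
  half-line at once, so no step-by-step continuation is needed. Boundedness of \<open>G\<close> keeps the
  Picard iterates of at most linear growth, so that they stay bounded after weighting.
  Continuity of \<open>s \<mapsto> G s (y s)\<close> off \<open>S\<close> serves twice: for integrability, and for recovering the
  differential equation from the integral equation at the times outside \<open>S\<close>.
\<close>

lemma global_solution_if_bounded_Lipschitz:
  fixes G :: "real \<Rightarrow> 'a::euclidean_space \<Rightarrow> 'a"
  assumes S: "\<And>b. finite (S \<inter> {0..b})"
    and cont: "\<And>y t. continuous_on UNIV y \<Longrightarrow> t \<ge> 0 \<Longrightarrow> t \<notin> S \<Longrightarrow>
                 continuous (at t within {0..}) (\<lambda>s. G s (y s))"
    and bound: "\<And>t y. t \<ge> 0 \<Longrightarrow> norm (G t y) \<le> M"
    and lip: "\<And>t. t \<ge> 0 \<Longrightarrow> L-lipschitz_on UNIV (G t)"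
  obtains x where "x 0 = x\<^sub>0" and "solves_on G x {0..}"
proof -
  have "M \<ge> 0" using bound[of 0 0] norm_ge_zero order_trans by blast
  have "L \<ge> 0" using lip[of 0] lipschitz_on_nonneg by blast
  define K where "K = 2 * L + 1"
  have "K > 0" using \<open>L \<ge> 0\<close> by (simp add: K_def)
  have integrable: "(\<lambda>s. G s (y s)) integrable_on {a..b}"
    if "continuous_on UNIV y" "0 \<le> a" for y a b
  proof (rule integrable_if_bounded_continuous_off_finite[OF S[of b], where M = M])
    show "continuous_on ({a..b} - S \<inter> {0..b}) (\<lambda>s. G s (y s))"
      unfolding continuous_on_eq_continuous_within
    proof
      fix t assume "t \<in> {a..b} - S \<inter> {0..b}"
      then show "continuous (at t within {a..b} - S \<inter> {0..b}) (\<lambda>s. G s (y s))"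
        using that(2) by (intro continuous_within_subset[OF cont[OF that(1)]]) auto
    qed
  qed (use bound that in auto)
  define \<Phi> where "\<Phi> y t = x\<^sub>0 + integral {0..t} (\<lambda>s. G s (exp (K * s) *\<^sub>R y s))" for y t
  have contexp: "continuous_on UNIV (\<lambda>s. exp (K * s) *\<^sub>R y s)"
    if "continuous_on UNIV y" for y :: "real \<Rightarrow> 'a"
    using that by (intro continuous_intros)
  have \<Phi>_lip: "M-lipschitz_on {0..} (\<Phi> y)" if y: "continuous_on UNIV y" for y
  proof (rule lipschitz_on_leI[OF _ \<open>M \<ge> 0\<close>])
    fix s t :: real assume st: "s \<in> {0..}" "t \<in> {0..}" "s \<le> t"
    let ?h = "\<lambda>s. G s (exp (K * s) *\<^sub>R y s)"
    have "integral {0..s} ?h + integral {s..t} ?h = integral {0..t} ?h"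
      using st by (intro Henstock_Kurzweil_Integration.integral_combine integrable contexp y) auto
    then have "\<Phi> y t - \<Phi> y s = integral {s..t} ?h"
      by (simp add: \<Phi>_def algebra_simps)
    moreover have "norm (integral {s..t} ?h) \<le> integral {s..t} (\<lambda>_. M)"
      using st by (intro integral_norm_bound_integral integrable contexp y bound) auto
    ultimately show "dist (\<Phi> y s) (\<Phi> y t) \<le> M * dist s t"
      using st by (subst dist_commute) (simp add: dist_norm mult.commute)
  qed
  have weight: "exp (- K * t) * (1 + t * K) \<le> 1" if "t \<ge> 0" for t
  proof -
    have "exp (- K * t) * (1 + t * K) \<le> exp (- K * t) * exp (t * K)"
      by (intro mult_left_mono exp_ge_add_one_self) auto
    also have "\<dots> = 1" by (simp add: exp_minus mult.commute)
    finally show ?thesis .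
  qed
  define T where "T y = (\<lambda>t. exp (- K * max 0 t) *\<^sub>R \<Phi> y (max 0 t))" for y
  have T_bcont: "T y \<in> bcontfun" if y: "continuous_on UNIV y" for y
    unfolding bcontfun_def
  proof (intro CollectI conjI)
    show "continuous_on UNIV (T y)"
      unfolding T_def
      by (intro continuous_intros
          continuous_on_compose2[OF lipschitz_on_continuous_on[OF \<Phi>_lip[OF y]]]) auto
    have "norm (T y t) \<le> norm x\<^sub>0 + M / K" for t
    proof -
      define \<tau> where "\<tau> = max 0 t"
      have \<tau>: "\<tau> \<ge> 0" by (simp add: \<tau>_def)
      have "dist (\<Phi> y \<tau>) (\<Phi> y 0) \<le> M * dist \<tau> 0"
        using \<tau> by (intro lipschitz_onD[OF \<Phi>_lip[OF y]]) auto
      then have "norm (\<Phi> y \<tau>) \<le> norm x\<^sub>0 + M * \<tau>"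
        using \<tau> norm_triangle_ineq2[of "\<Phi> y \<tau>" x\<^sub>0] by (simp add: \<Phi>_def dist_norm)
      then have "norm (T y t) \<le> exp (- K * \<tau>) * (norm x\<^sub>0 + M * \<tau>)"
        unfolding T_def \<tau>_def[symmetric] by (simp del: exp_minus)
      also have "\<dots> = exp (- K * \<tau>) * norm x\<^sub>0 + M / K * (exp (- K * \<tau>) * (\<tau> * K))"
        using \<open>K > 0\<close> by (simp add: field_simps)
      also have "\<dots> \<le> 1 * norm x\<^sub>0 + M / K * 1"
      proof (intro add_mono mult_right_mono mult_left_mono)
        have "exp (- K * \<tau>) + exp (- K * \<tau>) * (\<tau> * K) \<le> 1"
          using weight[OF \<tau>] by (simp add: distrib_left)
        then show "exp (- K * \<tau>) * (\<tau> * K) \<le> 1"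
          using exp_ge_zero[of "- K * \<tau>"] by linarith
      qed (use \<tau> \<open>K > 0\<close> \<open>M \<ge> 0\<close> in auto)
      finally show ?thesis by simp
    qed
    then show "bounded (range (T y))" unfolding bounded_iff by blast
  qed
  define \<T> where "\<T> y = Bcontfun (T (apply_bcontfun y))" for y :: "real \<Rightarrow>\<^sub>C 'a"
  have \<T>: "apply_bcontfun (\<T> y) = T (apply_bcontfun y)" for y
    unfolding \<T>_def by (rule Bcontfun_inverse[OF T_bcont]) simp
  have "dist (\<T> y) (\<T> z) \<le> (1/2) * dist y z" for y z
  proof (rule dist_bound)
    fix t :: real
    define \<tau> where "\<tau> = max 0 t"
    have \<tau>: "\<tau> \<ge> 0" by (simp add: \<tau>_def)
    let ?h = "\<lambda>y s. G s (exp (K * s) *\<^sub>R apply_bcontfun y s)"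
    have hi: "?h y integrable_on {0..\<tau>}" for y
      by (intro integrable contexp) auto
    have ei: "((\<lambda>s. L * (exp (K * s) * dist y z)) has_integral
        (L * dist y z / K) * exp (K * \<tau>) - (L * dist y z / K) * exp (K * 0)) {0..\<tau>}"
      using \<tau> \<open>K > 0\<close>
      by (intro fundamental_theorem_of_calculus)
         (auto intro!: derivative_eq_intros simp flip: has_real_derivative_iff_has_vector_derivative)
    have "norm (integral {0..\<tau>} (\<lambda>s. ?h y s - ?h z s))
        \<le> integral {0..\<tau>} (\<lambda>s. L * (exp (K * s) * dist y z))"
    proof (rule integral_norm_bound_integral)
      fix s assume s: "s \<in> {0..\<tau>}"
      have "norm (?h y s - ?h z s) \<le> L * norm (exp (K * s) *\<^sub>R y s - exp (K * s) *\<^sub>R z s)"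
        using s by (intro lipschitz_on_normD[OF lip]) auto
      also have "\<dots> = L * (exp (K * s) * dist (y s) (z s))"
        by (simp add: dist_norm flip: scaleR_diff_right)
      also have "\<dots> \<le> L * (exp (K * s) * dist y z)"
        using \<open>L \<ge> 0\<close> by (intro mult_left_mono dist_bounded) auto
      finally show "norm (?h y s - ?h z s) \<le> L * (exp (K * s) * dist y z)" .
    qed (use hi ei in \<open>auto intro: integrable_diff\<close>)
    also have "\<dots> = (L * dist y z / K) * (exp (K * \<tau>) - 1)"
      unfolding integral_unique[OF ei] by (simp add: right_diff_distrib)
    finally have *: "norm (\<Phi> y \<tau> - \<Phi> z \<tau>) \<le> (L * dist y z / K) * (exp (K * \<tau>) - 1)"
      by (simp add: \<Phi>_def integral_diff[OF hi hi])
    have "dist (\<T> y t) (\<T> z t) = exp (- K * \<tau>) * norm (\<Phi> y \<tau> - \<Phi> z \<tau>)"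
      unfolding \<T> T_def \<tau>_def[symmetric] by (simp add: dist_norm flip: scaleR_diff_right)
    also have "\<dots> \<le> exp (- K * \<tau>) * ((L * dist y z / K) * (exp (K * \<tau>) - 1))"
      by (intro mult_left_mono *) auto
    also have "\<dots> = (L * dist y z / K) * (1 - exp (- K * \<tau>))"
      by (simp add: exp_minus field_simps)
    also have "\<dots> \<le> (L * dist y z / K) * 1"
      using \<open>L \<ge> 0\<close> \<open>K > 0\<close> by (intro mult_left_mono) auto
    also have "\<dots> \<le> (1/2) * dist y z"
      using \<open>L \<ge> 0\<close> by (simp add: K_def field_simps mult_nonneg_nonneg)
    finally show "dist (\<T> y t) (\<T> z t) \<le> (1/2) * dist y z" .
  qed
  then obtain y where y: "\<T> y = y"
    using banach_fix_type[of "1/2" \<T>] by auto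
  define x where "x = (\<lambda>t. exp (K * t) *\<^sub>R apply_bcontfun y t)"
  have cx: "continuous_on UNIV x" unfolding x_def by (intro contexp) simp
  have x_eq: "x t = x\<^sub>0 + integral {0..t} (\<lambda>s. G s (x s))" if "t \<ge> 0" for t
  proof -
    have "apply_bcontfun y t = T (apply_bcontfun y) t"
      using \<T>[of y] y by simp
    then show ?thesis
      using that by (simp add: x_def T_def \<Phi>_def flip: exp_add)
  qed
  have "(x has_vector_derivative G t (x t)) (at t within {0..})" if t: "t \<ge> 0" "t \<notin> S" for t
  proof -
    have "((\<lambda>u. integral {0..u} (\<lambda>s. G s (x s))) has_vector_derivative G t (x t))
        (at t within ({0..t+1} - {}))"
      using t cont[OF cx t]
      by (intro integral_has_vector_derivative_continuous_at integrable cx)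
         (auto intro: continuous_within_subset)
    then have "((\<lambda>u. x\<^sub>0 + integral {0..u} (\<lambda>s. G s (x s))) has_vector_derivative G t (x t))
        (at t within {0..t+1})"
      using has_vector_derivative_add[OF has_vector_derivative_const[of x\<^sub>0]] by fastforce
    moreover have "at t within {0..t+1} = at t within {0..}"
      by (rule at_within_nhd[of _ "{..<t+1}"]) auto
    ultimately show ?thesis
      using t x_eq by (intro has_vector_derivative_transform_within[where g = x, OF _ zero_less_one]) auto
  qed
  then have "solves_on G x {0..}"
    unfolding solves_on_def
    using S continuous_on_subset[OF cx] by (intro conjI exI[of _ S]) auto
  moreover have "x 0 = x\<^sub>0" using x_eq[of 0] by simp
  ultimately show thesis by (rule that[rotated])
qed

section \<open>Lipschitz continuity of the error system on compact sets\<close>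

lemma lipschitz_on_bilinear_compact:
  assumes "bounded_bilinear h" and "compact X"
    and a: "C-lipschitz_on X a" and b: "D-lipschitz_on X b"
  shows "\<exists>L. L-lipschitz_on X (\<lambda>x. h (a x) (b x))"
proof -
  interpret bounded_bilinear h by fact
  obtain K where K: "\<And>u v. norm (h u v) \<le> norm u * norm v * K" "K \<ge> 0"
    using nonneg_bounded by blast
  have bdd: "bounded (a ` X)" "bounded (b ` X)"
    using a b \<open>compact X\<close>
    by (auto intro!: compact_imp_bounded compact_continuous_image lipschitz_on_continuous_on)
  obtain P where P: "\<And>x. x \<in> X \<Longrightarrow> norm (a x) \<le> P" "P \<ge> 0"
    using bdd(1) unfolding bounded_pos by (meson imageI less_imp_le)
  obtain Q where Q: "\<And>x. x \<in> X \<Longrightarrow> norm (b x) \<le> Q" "Q \<ge> 0"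
    using bdd(2) unfolding bounded_pos by (meson imageI less_imp_le)
  have "C \<ge> 0" "D \<ge> 0" using a b lipschitz_on_nonneg by auto
  have "(P * D * K + C * Q * K)-lipschitz_on X (\<lambda>x. h (a x) (b x))"
  proof (rule lipschitz_onI)
    fix x y assume xy: "x \<in> X" "y \<in> X"
    have "h (a x) (b x) - h (a y) (b y) = h (a x) (b x - b y) + h (a x - a y) (b y)"
      by (simp add: diff_left diff_right)
    then have "dist (h (a x) (b x)) (h (a y) (b y))
        \<le> norm (h (a x) (b x - b y)) + norm (h (a x - a y) (b y))"
      by (simp add: dist_norm norm_triangle_ineq)
    also have "\<dots> \<le> norm (a x) * norm (b x - b y) * K + norm (a x - a y) * norm (b y) * K"
      by (intro add_mono K)
    also have "\<dots> \<le> P * (D * dist x y) * K + (C * dist x y) * Q * K"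
      using xy P Q K(2) \<open>C \<ge> 0\<close> lipschitz_onD[OF a xy] lipschitz_onD[OF b xy]
      by (intro add_mono mult_right_mono mult_mono) (auto simp: dist_norm)
    finally show "dist (h (a x) (b x)) (h (a y) (b y)) \<le> (P * D * K + C * Q * K) * dist x y"
      by (simp add: algebra_simps)
  qed (use P Q K(2) \<open>C \<ge> 0\<close> \<open>D \<ge> 0\<close> in auto)
  then show ?thesis ..
qed

text \<open>
  With \<open>s = 1 + (norm z)\<^sup>2 \<ge> 1\<close>, the quotient \<open>s / (1 + \<epsilon> * s)\<close> increases in \<open>s\<close>, so its
  least value, attained at \<open>z = 0\<close>, is the bound. It is below \<open>1\<close>, hence also a bound for the
  square root and for the constant gain.
\<close>

lemma gain_ge:
  assumes "\<epsilon> > 0"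
  shows "1 / (1 + \<epsilon>) \<le> gain \<epsilon> i z"
proof -
  let ?p = "(1 + (norm z)\<^sup>2) / (1 + \<epsilon> * (1 + (norm z)\<^sup>2))"
  have "1 + \<epsilon> * (1 + (norm z)\<^sup>2) > 0"
    using assms by (intro add_pos_nonneg mult_nonneg_nonneg) auto
  then have p: "1 / (1 + \<epsilon>) \<le> ?p"
    using assms by (simp add: field_simps)
  have one: "1 / (1 + \<epsilon>) \<le> 1" using assms by simp
  \<comment> \<open>A number in \<open>[0,1]\<close> lies below its square root.\<close>
  have "(1 / (1 + \<epsilon>))\<^sup>2 \<le> 1 / (1 + \<epsilon>)"
    unfolding power2_eq_square using one assms by (intro mult_left_le) auto
  then have "1 / (1 + \<epsilon>) \<le> sqrt ?p"
    using p by (intro real_le_rsqrt) linarith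
  then show ?thesis using p one by (cases i) auto
qed

text \<open>
  With \<open>s = 1 + (norm z)\<^sup>2 \<ge> 1\<close>, the nonconstant gains are \<open>p s = s / (1 + \<epsilon> * s)\<close> and its square
  root; \<open>p\<close> is 1-Lipschitz on \<open>s \<ge> 1\<close>, and its values stay away from \<open>0\<close>, where the square root would fail to
  be Lipschitz.
\<close>

lemma lipschitz_on_gain:
  assumes "\<epsilon> > 0" and "compact X"
  shows "\<exists>L. L-lipschitz_on X (gain \<epsilon> i)"
proof -
  define p where "p s = s / (1 + \<epsilon> * s)" for s
  have p: "1-lipschitz_on {1..} p"
  proof (rule lipschitz_onI)
    fix s t :: real assume st: "s \<in> {1..}" "t \<in> {1..}"
    then have D: "1 \<le> 1 + \<epsilon> * s" "1 \<le> 1 + \<epsilon> * t" using assms by auto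
    then have "p s - p t = (s - t) / ((1 + \<epsilon> * s) * (1 + \<epsilon> * t))"
      by (simp add: p_def field_simps)
    moreover have "1 \<le> (1 + \<epsilon> * s) * (1 + \<epsilon> * t)"
      using mult_mono[OF D] D by auto
    ultimately show "dist (p s) (p t) \<le> 1 * dist s t"
      using D by (simp add: dist_real_def abs_mult divide_le_eq mult_left_le mult_le_cancel_left1)
  qed simp
  define c where "c = sqrt (1 / (1 + \<epsilon>))"
  have "c > 0" using assms by (simp add: c_def)
  have p_ge: "1 / (1 + \<epsilon>) \<le> p s" if "s \<ge> 1" for s
    using assms that by (simp add: p_def field_simps add_pos_nonneg)
  have sqrt: "(1 / c)-lipschitz_on {1 / (1 + \<epsilon>)..} sqrt"
  proof (rule lipschitz_onI)
    fix a b assume ab: "a \<in> {1 / (1 + \<epsilon>)..}" "b \<in> {1 / (1 + \<epsilon>)..}"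
    moreover have "0 \<le> 1 / (1 + \<epsilon>)" using assms by simp
    ultimately have "a \<ge> 0" "b \<ge> 0" by (meson atLeast_iff order_trans)+
    have c: "c \<le> sqrt a" "c \<le> sqrt b" using ab by (auto simp: c_def)
    have "\<bar>sqrt a - sqrt b\<bar> * c \<le> \<bar>sqrt a - sqrt b\<bar> * (sqrt a + sqrt b)"
      using c \<open>c > 0\<close> by (intro mult_left_mono) auto
    also have "\<dots> = \<bar>(sqrt a - sqrt b) * (sqrt a + sqrt b)\<bar>"
      using c \<open>c > 0\<close> by (simp add: abs_mult)
    also have "\<dots> = \<bar>a - b\<bar>"
      using \<open>a \<ge> 0\<close> \<open>b \<ge> 0\<close> by (simp add: algebra_simps)
    finally show "dist (sqrt a) (sqrt b) \<le> 1 / c * dist a b"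
      using \<open>c > 0\<close> by (simp add: dist_real_def field_simps)
  qed (use \<open>c > 0\<close> in simp)
  obtain L where "L-lipschitz_on X (\<lambda>z. z \<bullet> z)"
    using lipschitz_on_bilinear_compact[OF bounded_bilinear_inner \<open>compact X\<close>
        lipschitz_on_id lipschitz_on_id] by blast
  then have "(0 + L)-lipschitz_on X (\<lambda>z. 1 + (norm z)\<^sup>2)"
    unfolding power2_norm_eq_inner by (rule lipschitz_on_add[OF lipschitz_on_constant])
  then have I3: "(1 * (0 + L))-lipschitz_on X (\<lambda>z. p (1 + (norm z)\<^sup>2))"
    by (rule lipschitz_on_compose2) (auto intro: lipschitz_on_subset[OF p])
  then have I2: "(1 / c * (1 * (0 + L)))-lipschitz_on X (\<lambda>z. sqrt (p (1 + (norm z)\<^sup>2)))"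
    by (rule lipschitz_on_compose2) (use p_ge in \<open>auto intro: lipschitz_on_subset[OF sqrt]\<close>)
  show ?thesis
  proof (cases i)
    case i: I1
    have "gain \<epsilon> i = (\<lambda>z. 1)" by (simp add: i fun_eq_iff)
    then show ?thesis using lipschitz_on_constant by metis
  next
    case i: I2
    have "gain \<epsilon> i = (\<lambda>z. sqrt (p (1 + (norm z)\<^sup>2)))" by (simp add: i p_def fun_eq_iff)
    then show ?thesis using I2 by auto
  next
    case i: I3
    have "gain \<epsilon> i = (\<lambda>z. p (1 + (norm z)\<^sup>2))" by (simp add: i p_def fun_eq_iff)
    then show ?thesis using I3 by auto
  qed
qed

lemma g_mult_vec: "g z *v q = (1/2) *\<^sub>R (q + cross3 z q + (z \<bullet> q) *\<^sub>R z)"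
proof -
  have "(\<chi> i j. z $ i * z $ j) *v q = (z \<bullet> q) *\<^sub>R z"
    by (simp add: vec_eq_iff matrix_vector_mult_def inner_vec_def sum_distrib_left
        sum_distrib_right mult_ac)
  then show ?thesis
    by (simp add: g_def matrix_vector_mult_add_rdistrib skew_mult_vec
        flip: scaleR_matrix_vector_assoc)
qed

text \<open>
  The state and the rotated noise \<open>q\<close> are treated as one joint argument. A compact set of pairs then
  yields a Lipschitz constant uniform in \<open>q\<close>, and also the continuity and the bound required for
  the existence of solutions.
\<close>

lemma lipschitz_on_error_system:
  fixes X :: "((real^3) \<times> (real^3)) set"
  assumes "\<epsilon> > 0" and "compact X"
  shows "\<exists>L. L-lipschitz_on X (\<lambda>(z, q). - (gain \<epsilon> i z *\<^sub>R (bar A *v z)) - g z *v q)"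
proof -
  note bil = lipschitz_on_bilinear_compact[OF _ \<open>compact X\<close>]
  have "1-lipschitz_on X fst"
    by (intro lipschitz_onI) (simp_all add: dist_fst_le)
  note f = this
  have s: "1-lipschitz_on X snd"
    by (intro lipschitz_onI) (simp_all add: dist_snd_le)
  have "compact (fst ` X)"
    using \<open>compact X\<close> by (intro compact_continuous_image continuous_on_fst continuous_on_id)
  then obtain L1 where "L1-lipschitz_on (fst ` X) (gain \<epsilon> i)"
    using lipschitz_on_gain[OF \<open>\<epsilon> > 0\<close>] by blast
  then have k: "(L1 * 1)-lipschitz_on X (\<lambda>x. gain \<epsilon> i (fst x))"
    by (rule lipschitz_on_compose2[OF f])
  obtain L2 where "L2-lipschitz_on (fst ` X) ((*v) (bar A))"
    using bounded_linear.lipschitz_boundE[OF matrix_vector_mul_bounded_linear] by blast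
  then have Az: "(L2 * 1)-lipschitz_on X (\<lambda>x. bar A *v fst x)"
    by (rule lipschitz_on_compose2[OF f])
  have cross: "bounded_bilinear cross3"
    using bilinear_cross bilinear_conv_bounded_bilinear by blast
  obtain L3 where L3: "L3-lipschitz_on X (\<lambda>x. gain \<epsilon> i (fst x) *\<^sub>R (bar A *v fst x))"
    using bil[OF bounded_bilinear_scaleR k Az] by blast
  obtain L4 where L4: "L4-lipschitz_on X (\<lambda>x. cross3 (fst x) (snd x))"
    using bil[OF cross f s] by blast
  obtain L5 where "L5-lipschitz_on X (\<lambda>x. fst x \<bullet> snd x)"
    using bil[OF bounded_bilinear_inner f s] by blast
  then obtain L6 where L6: "L6-lipschitz_on X (\<lambda>x. (fst x \<bullet> snd x) *\<^sub>R fst x)"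
    using bil[OF bounded_bilinear_scaleR _ f] by blast
  show ?thesis
    unfolding case_prod_unfold g_mult_vec
    by (rule exI lipschitz_on_diff lipschitz_on_minus lipschitz_on_add lipschitz_on_cmult L3 L4 L6 s)+
qed



section \<open>The smallest eigenvalue as minimum of the Rayleigh quotient\<close>

text \<open>
  Let \<open>m\<close> be the minimum of \<open>v \<bullet> (M *v v)\<close> over the unit sphere, attained at \<open>v\<close>. The form of
  \<open>N = M - m\<close> is nonnegative and vanishes at \<open>v\<close>, so moving from \<open>v\<close> in the direction \<open>- N v\<close> must not
  decrease it to first order; this forces \<open>N v = 0\<close>. Hence \<open>m\<close> is an eigenvalue, no eigenvalue
  is smaller, and it is the one picked by \<open>lambda_min\<close>.
\<close>

lemma lambda_min_pos_def:
  fixes M :: "real^'n^'n"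
  assumes M: "pos_def M"
  shows "lambda_min M > 0" and "lambda_min M * (norm z)\<^sup>2 \<le> z \<bullet> (M *v z)"
proof -
  have sym: "x \<bullet> (M *v y) = (M *v x) \<bullet> y" for x y
    using M unfolding pos_def_def by (metis dot_lmul_matrix vector_transpose_matrix)
  have "continuous_on (sphere 0 1) (\<lambda>v. v \<bullet> (M *v v))"
    by (intro continuous_intros matrix_vector_mult_linear_continuous_on)
  moreover have "sphere (0 :: real^'n) 1 \<noteq> {}" by simp
  ultimately obtain v where v: "v \<in> sphere 0 1"
    and min: "\<And>w. w \<in> sphere 0 1 \<Longrightarrow> v \<bullet> (M *v v) \<le> w \<bullet> (M *v w)"
    using continuous_attains_inf[OF compact_sphere, of "0::real^'n" 1 "\<lambda>v. v \<bullet> (M *v v)"]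
    by blast
  define m where "m = v \<bullet> (M *v v)"
  have nv: "norm v = 1" "v \<noteq> 0" using v by auto
  then have "m > 0" using M by (simp add: m_def pos_def_def)
  have rayleigh: "m * (norm w)\<^sup>2 \<le> w \<bullet> (M *v w)" for w
  proof (cases "w = 0")
    case False
    then have "m \<le> (w /\<^sub>R norm w) \<bullet> (M *v (w /\<^sub>R norm w))"
      unfolding m_def by (intro min) simp
    also have "\<dots> = (w \<bullet> (M *v w)) / (norm w)\<^sup>2"
      by (simp add: matrix_vector_mult_scaleR power2_eq_square field_simps)
    finally show ?thesis using False by (simp add: field_simps)
  qed simp
  have "M *v v = m *\<^sub>R v"
  proof -
    define N where "N w = M *v w - m *\<^sub>R w" for w
    define u where "u = N v"
    have N_nonneg: "w \<bullet> N w \<ge> 0" for w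
      using rayleigh[of w] by (simp add: N_def inner_diff_right power2_norm_eq_inner)
    have vNv: "v \<bullet> N v = 0"
      using nv by (simp add: N_def inner_diff_right m_def norm_eq_1)
    have quad: "0 \<le> t\<^sup>2 * (u \<bullet> N u) - 2 * t * (u \<bullet> u)" for t
    proof -
      have lin: "N (v - t *\<^sub>R u) = u - t *\<^sub>R N u"
        by (simp add: u_def N_def matrix_vector_mult_diff_distrib matrix_vector_mult_scaleR algebra_simps)
      have "v \<bullet> N u = u \<bullet> u"
        by (simp add: u_def[symmetric] N_def inner_diff_right sym)
           (simp add: u_def N_def inner_diff_left)
      moreover have "v \<bullet> u = 0" using vNv by (simp add: u_def)
      ultimately have "(v - t *\<^sub>R u) \<bullet> N (v - t *\<^sub>R u) = t\<^sup>2 * (u \<bullet> N u) - 2 * t * (u \<bullet> u)"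
        unfolding lin by (simp add: inner_diff_left inner_diff_right power2_eq_square algebra_simps)
      then show ?thesis using N_nonneg[of "v - t *\<^sub>R u"] by simp
    qed
    have "u \<bullet> u = 0"
    proof (rule ccontr)
      assume "u \<bullet> u \<noteq> 0"
      then have uu: "u \<bullet> u > 0" by simp
      define K where "K = u \<bullet> N u + 1"
      have K: "K > 0" "u \<bullet> N u \<le> K" using N_nonneg[of u] by (auto simp: K_def)
      let ?t = "(u \<bullet> u) / K"
      have "?t\<^sup>2 * (u \<bullet> N u) \<le> ?t\<^sup>2 * K" using K by (intro mult_left_mono) auto
      also have "\<dots> = ?t * (u \<bullet> u)" using K by (simp add: power2_eq_square)
      finally have "?t * (u \<bullet> u) \<le> 0" using quad[of ?t] by linarith
      moreover have "?t * (u \<bullet> u) > 0" using uu K by simp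
      ultimately show False by simp
    qed
    then show ?thesis by (simp add: u_def N_def)
  qed
  then have "is_eigenvalue M m" using nv by (auto simp: is_eigenvalue_def)
  moreover have "m \<le> l" if "is_eigenvalue M l" for l
  proof -
    obtain w where w: "w \<noteq> 0" "M *v w = l *\<^sub>R w"
      using \<open>is_eigenvalue M l\<close> by (auto simp: is_eigenvalue_def)
    then have "m * (norm w)\<^sup>2 \<le> l * (norm w)\<^sup>2"
      using rayleigh[of w] by (simp add: power2_norm_eq_inner)
    then show ?thesis using w by simp
  qed
  ultimately have "lambda_min M = m"
    unfolding lambda_min_def by (rule Least_equality)
  then show "lambda_min M > 0" "lambda_min M * (norm z)\<^sup>2 \<le> z \<bullet> (M *v z)"
    using \<open>m > 0\<close> rayleigh by auto
qed

section \<open>Dissipation along the error system\<close>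

text \<open>
  Equality holds for \<open>norm z = r\<close>: \<open>varsigma\<close> is the ratio of the noise amplification
  \<open>1 + (norm z)\<^sup>2\<close> to the gain, as a function of \<open>norm z\<close>, and this ratio is increasing.
\<close>

lemma one_plus_square_le_gain_mult_varsigma:
  assumes "\<epsilon> > 0" and "norm z \<le> r"
  shows "1 + (norm z)\<^sup>2 \<le> gain \<epsilon> i z * varsigma \<epsilon> i r"
proof -
  define s where "s = 1 + (norm z)\<^sup>2"
  define q where "q = 1 + r\<^sup>2"
  have s: "1 \<le> s" "s \<le> q"
    using power_mono[OF assms(2), of 2] by (auto simp: s_def q_def)
  define S where "S = 1 + \<epsilon> * s"
  define Q where "Q = 1 + \<epsilon> * q"
  have SQ: "0 < S" "S \<le> Q"
    using s assms(1) by (auto simp: S_def Q_def intro: add_pos_nonneg)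
  have one: "s \<le> s / S * Q"
    using SQ s by (simp add: field_simps mult_left_mono)
  have "s\<^sup>2 \<le> (s / S * Q) * q"
    unfolding power2_eq_square using one s by (intro mult_mono) auto
  then have "s \<le> sqrt (s / S * (q * Q))"
    by (intro real_le_rsqrt) (simp add: mult_ac)
  then have two: "s \<le> sqrt (s / S) * sqrt (q * Q)"
    by (simp only: real_sqrt_mult)
  have Q: "1 + \<epsilon> + \<epsilon> * r\<^sup>2 = Q" by (simp add: Q_def q_def algebra_simps)
  have "gain \<epsilon> I2 z = sqrt (s / S)" "varsigma \<epsilon> I2 r = sqrt (q * Q)"
    "gain \<epsilon> I3 z = s / S" "varsigma \<epsilon> I3 r = Q" "varsigma \<epsilon> I1 r = q"
    by (simp_all only: gain.simps varsigma.simps Q s_def S_def q_def)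
  then show ?thesis
    unfolding s_def[symmetric] using one two s by (cases i) (simp_all del: varsigma.simps gain.simps(2,3))
qed

lemma varsigma_pos: "\<epsilon> > 0 \<Longrightarrow> varsigma \<epsilon> i r > 0"
  by (cases i) (auto intro!: add_pos_nonneg mult_pos_pos)

lemma inner_g_mult_vec: "z \<bullet> (g z *v q) = (1 + (norm z)\<^sup>2) / 2 * (z \<bullet> q)"
  by (simp add: g_mult_vec inner_add_right dot_cross_self power2_norm_eq_inner algebra_simps add_divide_distrib)

lemma norm_SO3_mult_vec: "R \<in> SO3 \<Longrightarrow> norm (R *v x) = norm x"
  using orthogonal_transformation_matrix[of "(*v) R"]
  by (auto simp: SO3_def rotation_matrix_def intro!: orthogonal_transformation_norm)

text \<open>
  The lower bound on \<open>norm z\<close> says exactly that \<open>varsigma \<epsilon> i r * b / 2\<close> is at most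
  \<open>\<rho> * lambda_min (bar A) * norm z\<close>, so the noise cancels no more than the fraction \<open>\<rho>\<close> of
  the damping.
\<close>

lemma error_system_dissipation:
  assumes "pos_def (bar A)" and "\<epsilon> > 0" and \<rho>: "0 < \<rho>" "\<rho> < 1" and R: "R \<in> SO3"
    and n: "norm n \<le> b" and z: "iss_gain A \<epsilon> i r \<rho> b \<le> norm z" "norm z \<le> r"
  shows "z \<bullet> error_system A \<epsilon> i z R n \<le> - ((1 - \<rho>) * lambda_min (bar A) / (1 + \<epsilon>)) * (norm z)\<^sup>2"
proof -
  note lm = lambda_min_pos_def[OF assms(1)]
  define l where "l = lambda_min (bar A)"
  define k where "k = gain \<epsilon> i z"
  have k: "k \<ge> 1 / (1 + \<epsilon>)" using gain_ge[OF \<open>\<epsilon> > 0\<close>] by (simp add: k_def)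
  moreover have "1 / (1 + \<epsilon>) > 0" using \<open>\<epsilon> > 0\<close> by simp
  ultimately have "k > 0" by linarith
  have "b \<ge> 0" using n norm_ge_zero order_trans by blast
  have l_pos: "l > 0" using lm by (simp add: l_def)
  have damping: "l * (norm z)\<^sup>2 \<le> z \<bullet> (bar A *v z)" using lm by (simp add: l_def)
  have small: "varsigma \<epsilon> i r * b / 2 \<le> \<rho> * l * norm z"
    using z(1) \<rho>(1) l_pos by (simp add: iss_gain_def field_simps flip: l_def)
  have "- (z \<bullet> (R *v n)) \<le> norm z * b"
  proof -
    have "- (z \<bullet> (R *v n)) \<le> norm z * norm (R *v n)"
      using Cauchy_Schwarz_ineq2[of z "R *v n"] by linarith
    also have "\<dots> \<le> norm z * b" using n R by (simp add: norm_SO3_mult_vec mult_left_mono)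
    finally show ?thesis .
  qed
  then have "(1 + (norm z)\<^sup>2) / 2 * - (z \<bullet> (R *v n)) \<le> (1 + (norm z)\<^sup>2) / 2 * (norm z * b)"
    by (intro mult_left_mono) auto
  also have "\<dots> \<le> (k * varsigma \<epsilon> i r) / 2 * (norm z * b)"
    using one_plus_square_le_gain_mult_varsigma[OF \<open>\<epsilon> > 0\<close> z(2), of i] \<open>b \<ge> 0\<close>
    by (intro mult_right_mono divide_right_mono) (auto simp: k_def)
  also have "\<dots> = k * norm z * (varsigma \<epsilon> i r * b / 2)" by simp
  also have "\<dots> \<le> k * norm z * (\<rho> * l * norm z)"
    using small \<open>k > 0\<close> by (intro mult_left_mono) auto
  finally have noise: "- (z \<bullet> (g z *v (R *v n))) \<le> k * (\<rho> * (l * (norm z)\<^sup>2))"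
    by (simp add: inner_g_mult_vec power2_eq_square mult_ac)
  have "z \<bullet> error_system A \<epsilon> i z R n = - (k * (z \<bullet> (bar A *v z))) - z \<bullet> (g z *v (R *v n))"
    by (simp add: error_system_def inner_diff_right k_def)
  also have "\<dots> \<le> - (k * (l * (norm z)\<^sup>2)) + k * (\<rho> * (l * (norm z)\<^sup>2))"
    using noise mult_left_mono[OF damping, of k] \<open>k > 0\<close> by linarith
  also have "\<dots> = - (k * ((1 - \<rho>) * l * (norm z)\<^sup>2))" by (simp add: algebra_simps)
  also have "\<dots> \<le> - (1 / (1 + \<epsilon>) * ((1 - \<rho>) * l * (norm z)\<^sup>2))"
    using k \<rho> l_pos by (intro le_imp_neg_le mult_right_mono) auto
  finally show ?thesis by (simp add: l_def)
qed

section \<open>The input-to-state stability estimate\<close>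

lemma continuous_matrix_vector_mult:
  fixes M :: "'b::t2_space \<Rightarrow> real^'n^'m"
  assumes "continuous F M" and "continuous F v"
  shows "continuous F (\<lambda>t. M t *v v t)"
  using assms unfolding continuous_def matrix_vector_mult_def
  by (intro vec_tendstoI) (auto intro!: tendsto_intros)

lemma class_KL_exp_decay:
  assumes "\<mu> > 0"
  shows "class_KL (\<lambda>s t. s * exp (- \<mu> * t))"
  unfolding class_KL_def
proof (intro conjI allI impI)
  show "continuous_on ({0..} \<times> {0..}) (\<lambda>(s, t). s * exp (- \<mu> * t))"
    unfolding case_prod_unfold by (intro continuous_intros)
  show "class_K (\<lambda>s. s * exp (- \<mu> * t))" for t
    unfolding class_K_def by (auto intro!: continuous_intros strict_mono_onI)
  fix s :: real assume "s \<ge> 0"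
  then show "antimono_on {0..} (\<lambda>t. s * exp (- \<mu> * t))"
    using assms by (auto intro!: monotone_onI mult_left_mono)
  have "((\<lambda>t. exp (- \<mu> * t)) \<longlongrightarrow> 0) at_top"
    using assms
    by (intro filterlim_compose[OF exp_at_bot] filterlim_tendsto_neg_mult_at_bot[OF tendsto_const])
       (auto simp: filterlim_ident)
  then show "((\<lambda>t. s * exp (- \<mu> * t)) \<longlongrightarrow> 0) at_top"
    by (rule tendsto_mult_right_zero)
qed

lemma iss_gain_linear:
  assumes "pos_def (bar A)" and "\<epsilon> > 0" and "\<rho> > 0"
  obtains c where "c > 0" and "iss_gain A \<epsilon> i r \<rho> = (\<lambda>s. c * s)"
proof (rule that[of "varsigma \<epsilon> i r / (2 * \<rho> * lambda_min (bar A))"])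
  show "varsigma \<epsilon> i r / (2 * \<rho> * lambda_min (bar A)) > 0"
    using varsigma_pos[OF assms(2)] lambda_min_pos_def(1)[OF assms(1)] assms(3) by simp
qed (simp add: iss_gain_def fun_eq_iff)

lemma inv_into_nonneg_mult_left:
  fixes c r :: real
  assumes "c > 0" and "r \<ge> 0"
  shows "inv_into {0..} (\<lambda>s. c * s) r = r / c"
  using assms by (intro inv_into_f_eq) (auto intro: inj_onI)

text \<open>
  The estimate is obtained with the maximum of the decaying term and the gain term in place of
  their sum. The maximum matters: it stays below \<open>r\<close>, which is what makes the truncated and the
  original system share their solutions.
\<close>

lemma error_system_estimate:
  assumes pd: "pos_def (bar A)" and \<epsilon>: "\<epsilon> > 0" and \<rho>: "0 < \<rho>" "\<rho> < 1" and r: "r > 0"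
  defines "\<mu> \<equiv> (1 - \<rho>) * lambda_min (bar A) / (1 + \<epsilon>)"
  shows "iss_estimate SO3 (error_system A \<epsilon> i) r (inv_into {0..} (iss_gain A \<epsilon> i r \<rho>) r)
           (\<lambda>s t. s * exp (- \<mu> * t)) (iss_gain A \<epsilon> i r \<rho>)"
  unfolding iss_estimate_def
proof (intro allI impI, elim conjE)
  fix x\<^sub>0 :: "real^3" and w :: "real \<Rightarrow> real^3^3" and u :: "real \<Rightarrow> real^3"
  assume x0: "norm x\<^sub>0 < r" and w: "piecewise_continuous w" "\<forall>t\<ge>0. w t \<in> SO3"
    and u: "piecewise_continuous u" "bounded (u ` {0..})"
    and small: "sup_norm u < inv_into {0..} (iss_gain A \<epsilon> i r \<rho>) r"
  define F where "F = (\<lambda>t y. error_system A \<epsilon> i y (w t) (u t))"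
  define b where "b = sup_norm u"
  have ub: "norm (u t) \<le> b" if "t \<ge> 0" for t
    unfolding b_def using that u(2)
    by (intro cSUP_upper) (auto simp: bounded_iff bdd_above_def)
  have "b \<ge> 0" using ub[of 0] norm_ge_zero order_trans by blast
  obtain c where c: "c > 0" "iss_gain A \<epsilon> i r \<rho> = (\<lambda>s. c * s)"
    using iss_gain_linear[OF pd \<epsilon> \<rho>(1)] .
  define d where "d = iss_gain A \<epsilon> i r \<rho> b"
  have d: "0 \<le> d" "d < r"
    using small c(1) r \<open>b \<ge> 0\<close>
    unfolding d_def c(2) inv_into_nonneg_mult_left[OF c(1) less_imp_le[OF r]] b_def[symmetric]
    by (simp_all add: field_simps)
  have "\<mu> > 0" using lambda_min_pos_def(1)[OF pd] \<rho> \<epsilon> by (simp add: \<mu>_def)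
  have decay: "z \<bullet> F t z \<le> - \<mu> * (norm z)\<^sup>2" if "t \<ge> 0" "d < norm z" "norm z < r" for t z
    unfolding F_def \<mu>_def using that w(2) ub pd \<epsilon> \<rho>
    by (intro error_system_dissipation[where b = b and r = r]) (auto simp: d_def)
  have bound: "norm (x t) \<le> norm x\<^sub>0 * exp (- \<mu> * t) + d"
    if "is_interval J \<and> 0 \<in> J \<and> J \<subseteq> {0..} \<and> x 0 = x\<^sub>0 \<and> solves_on F x J" "t \<in> J" for J x t
  proof -
    have "norm (x t) \<le> max (norm (x 0) * exp (- \<mu> * t)) d"
      using that x0 \<open>\<mu> > 0\<close> d decay by (intro norm_decay_outside_ball[of F x J d r]) auto
    also have "\<dots> \<le> norm (x 0) * exp (- \<mu> * t) + d" using d by auto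
    finally show ?thesis using that by simp
  qed
  have "\<exists>x. x 0 = x\<^sub>0 \<and> solves_on F x {0..}"
  proof -
    define P where "P = closest_point (cball (0::real^3) r)"
    have P_in: "P y \<in> cball 0 r" for y
      unfolding P_def using r by (intro closest_point_in_set) auto
    have P_id: "P y = y" if "norm y < r" for y
      unfolding P_def using that by (intro closest_point_self) simp
    have P_lip: "dist (P y) (P z) \<le> dist y z" for y z
      unfolding P_def using r by (intro closest_point_lipschitz) auto
    define X where "X = cball (0::real^3) r \<times> cball (0::real^3) b"
    define h where "h = (\<lambda>(z, q). - (gain \<epsilon> i z *\<^sub>R (bar A *v z)) - g z *v q)"
    have "compact X" unfolding X_def by (intro compact_Times compact_cball)
    then obtain L where L: "L-lipschitz_on X h"
      unfolding h_def using lipschitz_on_error_system[OF \<epsilon>] by blast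
    have ch: "continuous_on X h" using L by (rule lipschitz_on_continuous_on)
    then obtain M where M: "\<And>p. p \<in> X \<Longrightarrow> norm (h p) \<le> M"
      using compact_imp_bounded[OF compact_continuous_image[OF ch \<open>compact X\<close>]]
      unfolding bounded_iff by blast
    define G where "G = (\<lambda>t y. F t (P y))"
    have G: "G t y = h (P y, w t *v u t)" for t y
      by (simp add: G_def F_def h_def error_system_def)
    have inX: "(P y, w t *v u t) \<in> X" if "t \<ge> 0" for t y
      using P_in[of y] ub[OF that] w(2) that by (simp add: X_def norm_SO3_mult_vec)
    define S where "S = {t \<in> {0..}. \<not> (continuous (at t within {0..}) w \<and>
                                         continuous (at t within {0..}) u)}"
    obtain x where x: "x 0 = x\<^sub>0" "solves_on G x {0..}"
    proof (rule global_solution_if_bounded_Lipschitz[of S G M L x\<^sub>0])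
      fix b'
      have "S \<inter> {0..b'} \<subseteq> {t \<in> {0..b'}. \<not> continuous (at t within {0..}) w} \<union>
                          {t \<in> {0..b'}. \<not> continuous (at t within {0..}) u}"
        by (auto simp: S_def)
      then show "finite (S \<inter> {0..b'})"
        by (rule finite_subset) (use w(1) u(1) in \<open>simp add: piecewise_continuous_def\<close>)
    next
      fix y :: "real \<Rightarrow> real^3" and t :: real
      assume y: "continuous_on UNIV y" and t: "t \<ge> 0" "t \<notin> S"
      let ?p = "\<lambda>s. (P (y s), w s *v u s)"
      have "continuous_on UNIV (\<lambda>s. P (y s))"
        unfolding P_def using r
        by (intro continuous_on_compose2[OF continuous_on_closest_point y]) auto
      then have "continuous (at t within {0..}) (\<lambda>s. P (y s))"
        by (simp add: continuous_on_eq_continuous_at continuous_at_imp_continuous_at_within)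
      moreover have "continuous (at t within {0..}) w" "continuous (at t within {0..}) u"
        using t by (auto simp: S_def)
      ultimately have "continuous (at t within {0..}) ?p"
        by (intro continuous_Pair continuous_matrix_vector_mult)
      moreover have "continuous (at (?p t) within X) h"
        using ch inX[OF t(1)] unfolding continuous_on_eq_continuous_within by blast
      then have "continuous (at (?p t) within ?p ` {0..}) h"
        by (rule continuous_within_subset) (use inX in auto)
      ultimately show "continuous (at t within {0..}) (\<lambda>s. G s (y s))"
        unfolding G by (rule continuous_within_compose2)
    next
      show "norm (G t y) \<le> M" if "t \<ge> 0" for t y
        unfolding G using inX[OF that] by (rule M)
      show "L-lipschitz_on UNIV (G t)" if "t \<ge> 0" for t
      proof (rule lipschitz_onI)
        fix y z
        have "dist (G t y) (G t z) \<le> L * dist (P y) (P z)"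
          unfolding G using lipschitz_onD[OF L inX[OF that] inX[OF that], of y z]
          by (simp add: dist_Pair_Pair)
        also have "\<dots> \<le> L * dist y z"
          using P_lip lipschitz_on_nonneg[OF L] by (rule mult_left_mono)
        finally show "dist (G t y) (G t z) \<le> L * dist y z" .
      qed (rule lipschitz_on_nonneg[OF L])
    qed
    \<comment> \<open>The solution never reaches the sphere of radius \<open>r\<close>, hence never feels the truncation.\<close>
    have "norm (x t) < r" if "t \<ge> 0" for t
    proof -
      have "norm (x t) \<le> max (norm (x 0) * exp (- \<mu> * t)) d"
        using x x0 \<open>\<mu> > 0\<close> d decay that
        by (intro norm_decay_outside_ball[of G x "{0..}" d r]) (auto simp: G_def P_id is_interval_ci)
      also have "norm (x 0) * exp (- \<mu> * t) \<le> norm (x 0) * 1"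
        using that \<open>\<mu> > 0\<close> by (intro mult_left_mono) auto
      then have "max (norm (x 0) * exp (- \<mu> * t)) d < r" using d x0 x by simp
      finally show ?thesis .
    qed
    then have "solves_on F x {0..}"
      using x(2) by (fastforce simp: solves_on_def G_def P_id)
    with x(1) show ?thesis by blast
  qed
  with bound show "(\<exists>x. x 0 = x\<^sub>0 \<and> solves_on (\<lambda>t y. error_system A \<epsilon> i y (w t) (u t)) x {0..}) \<and>
      (\<forall>J x. is_interval J \<and> 0 \<in> J \<and> J \<subseteq> {0..} \<and>
             x 0 = x\<^sub>0 \<and> solves_on (\<lambda>t y. error_system A \<epsilon> i y (w t) (u t)) x J \<longrightarrow>
             (\<forall>t\<in>J. norm (x t) \<le> norm x\<^sub>0 * exp (- \<mu> * t) + iss_gain A \<epsilon> i r \<rho> (sup_norm u)))"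
    unfolding F_def d_def b_def by blast
qed

theorem theorem4:
  fixes A :: "real^3^3" and \<epsilon> :: real
  assumes "transpose A = A"
    and "pos_def (bar A)"
    and "\<epsilon> > 0"
  shows "\<forall>i. locally_iss SO3 (error_system A \<epsilon> i) \<and>
           (\<forall>r \<rho>. r > 0 \<and> 0 < \<rho> \<and> \<rho> < 1 \<longrightarrow>
             (\<exists>\<beta>. class_KL \<beta> \<and>
               iss_estimate SO3 (error_system A \<epsilon> i)
                 r (inv_into {0..} (iss_gain A \<epsilon> i r \<rho>) r) \<beta> (iss_gain A \<epsilon> i r \<rho>)))"
proof
  fix i
  have main: "\<exists>\<beta>. class_KL \<beta> \<and>
      iss_estimate SO3 (error_system A \<epsilon> i)
        r (inv_into {0..} (iss_gain A \<epsilon> i r \<rho>) r) \<beta> (iss_gain A \<epsilon> i r \<rho>)"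
    if "r > 0" "0 < \<rho>" "\<rho> < 1" for r \<rho>
  proof -
    have "(1 - \<rho>) * lambda_min (bar A) / (1 + \<epsilon>) > 0"
      using lambda_min_pos_def(1)[OF assms(2)] assms(3) that by simp
    then show ?thesis
      using class_KL_exp_decay error_system_estimate[OF assms(2,3) that(2,3,1)] by blast
  qed
  obtain c where c: "c > 0" "iss_gain A \<epsilon> i 1 (1/2) = (\<lambda>s. c * s)"
    using iss_gain_linear[OF assms(2,3), of "1/2"] by auto
  obtain \<beta> where "class_KL \<beta>"
    "iss_estimate SO3 (error_system A \<epsilon> i)
       1 (inv_into {0..} (iss_gain A \<epsilon> i 1 (1/2)) 1) \<beta> (iss_gain A \<epsilon> i 1 (1/2))"
    using main[of 1 "1/2"] by auto
  moreover have "class_K (iss_gain A \<epsilon> i 1 (1/2))"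
    unfolding class_K_def c(2) using c(1)
    by (auto intro!: continuous_intros strict_mono_onI)
  moreover have "inv_into {0..} (iss_gain A \<epsilon> i 1 (1/2)) 1 > 0"
    using c by (simp add: inv_into_nonneg_mult_left)
  ultimately have "locally_iss SO3 (error_system A \<epsilon> i)"
    unfolding locally_iss_def using zero_less_one by blast
  with main show "locally_iss SO3 (error_system A \<epsilon> i) \<and>
      (\<forall>r \<rho>. r > 0 \<and> 0 < \<rho> \<and> \<rho> < 1 \<longrightarrow>
        (\<exists>\<beta>. class_KL \<beta> \<and>
          iss_estimate SO3 (error_system A \<epsilon> i)
            r (inv_into {0..} (iss_gain A \<epsilon> i r \<rho>) r) \<beta> (iss_gain A \<epsilon> i r \<rho>)))"
    by blast
qed

end
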